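(* Let $r$ be a prime number, $m$ a positive integer, $N>1$ an integer with $N\mid (r^m-1)$. Let $q$ be a power of a prime $p$ with $\gcd(p,r)=1$ and $N\mid (q-1)$. Let $\varphi:\mathbb{F}_{r^m}^*\to\mathbb{F}_q^*$ be the homomorphism of order $N$ defined in the context, let $P$ be the $r^m\times r^m$ matrix over $\mathbb{F}_q$ defined in the context with diagonal value $v=0$, and let $C=C_{(\varphi,0)}$ be the linear code over $\mathbb{F}_q$ with generator matrix $[I_{r^m},P]$. Then: (1) If there exists a positive integer $s$ such that $N\mid (p^s-1)$ and $\varphi(p^{2s})\neq 1$, then $C$ is a $[2r^m,r^m]$ LCD code over $\mathbb{F}_q$. In particular, if $\varphi(q^2)\neq 1$, then $C$ is a $[2r^m,r^m]$ LCD code over $\mathbb{F}_q$. (2) If there exists a positive integer $s$ such that $N\mid (p^s+1)$ and $\varphi(p^{-2s})\neq r^{2m}$ (as elements of $\mathbb{F}_q$), then $C$ is a $[2r^m,r^m]$ LCD code over $\mathbb{F}_q$.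
   Context: Fix a primitive element $\alpha$ of $\mathbb{F}_{r^m}$ and a primitive element $\beta$ of $\mathbb{F}_q$, and put $u=\beta^{(q-1)/N}$. Define $\varphi:\mathbb{F}_{r^m}^*\to\mathbb{F}_q^*$ by $\varphi(\alpha^k)=u^k$ for $0\le k\le r^m-2$; this is a group homomorphism of order $N$. Integers prime to $r$ (such as $p$, $q$ and their powers, including negative powers) are regarded as elements of $\mathbb{F}_{r^m}^*$ when $\varphi$ is applied to them, and integers are regarded as elements of $\mathbb{F}_q$ when compared with elements of $\mathbb{F}_q$. Enumerate $\mathbb{F}_{r^m}=\{x_i:1\le i\le r^m\}$. For $v\in\mathbb{F}_q$, $P=(p_{ij})$ is the $r^m\times r^m$ matrix over $\mathbb{F}_q$ with $p_{ij}=\varphi(x_j-x_i)$ for $i\ne j$ and $p_{ii}=v$. $C_{(\varphi,v)}$ denotes the linear code over $\mathbb{F}_q$ generated by the rows of $[I_{r^m},P]$. An $[n,k]$ linear code over $\mathbb{F}_q$ is a $k$-dimensional subspace of $\mathbb{F}_q^n$; $C^\perp$ is its dual for the inner product $\langle u,w\rangle=\sum_i u_iw_i$. $C$ is LCD (linear complementary dual) if $C\cap C^\perp=\{0\}$. *)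

theory Defs
  imports
    "Jordan_Normal_Form.VS_Connect"
    "HOL-Computational_Algebra.Primes"
    "HOL-Library.Cardinality"
begin

text \<open>A generator of the multiplicative group of a finite field.\<close>

definition primitive_element :: "'a::{finite,field} \<Rightarrow> bool" where
  "primitive_element a \<longleftrightarrow> a \<noteq> 0 \<and> (\<forall>x. x \<noteq> 0 \<longrightarrow> (\<exists>k::nat. x = a ^ k))"

text \<open>
  The map \<open>\<alpha>^k \<mapsto> u^k\<close> for \<open>0 \<le> k \<le> |F| - 2\<close>, with \<open>u = \<beta>^((q-1)/N)\<close>. It is meaningful for
  nonzero arguments only, and all uses are restricted to these.
\<close>

definition phi :: "'a::{finite,field} \<Rightarrow> 'b::{finite,field} \<Rightarrow> nat \<Rightarrow> 'a \<Rightarrow> 'b" where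
  "phi \<alpha> \<beta> N y =
     (let u = \<beta> ^ ((CARD('b) - 1) div N)
      in u ^ (THE k. k \<le> CARD('a) - 2 \<and> \<alpha> ^ k = y))"

text \<open>
  The enumeration \<open>x\<close> of the field is indexed from 0, in line with matrix indices.
\<close>

definition P_mat :: "('a::{finite,field} \<Rightarrow> 'b::{finite,field}) \<Rightarrow> 'b \<Rightarrow> (nat \<Rightarrow> 'a) \<Rightarrow> 'b mat" where
  "P_mat \<phi> v x = mat CARD('a) CARD('a) (\<lambda>(i, j). if i = j then v else \<phi> (x j - x i))"

text \<open>The block matrix \<open>[I, P]\<close>: the lower blocks have no rows.\<close>

definition gen_mat :: "('a::{finite,field} \<Rightarrow> 'b::{finite,field}) \<Rightarrow> 'b \<Rightarrow> (nat \<Rightarrow> 'a) \<Rightarrow> 'b mat" where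
  "gen_mat \<phi> v x =
     four_block_mat (1\<^sub>m CARD('a)) (P_mat \<phi> v x) (0\<^sub>m 0 CARD('a)) (0\<^sub>m 0 CARD('a))"

definition char_code :: "('a::{finite,field} \<Rightarrow> 'b::{finite,field}) \<Rightarrow> 'b \<Rightarrow> (nat \<Rightarrow> 'a) \<Rightarrow> 'b vec set" where
  "char_code \<phi> v x = vec_space.row_space (2 * CARD('a)) (gen_mat \<phi> v x)"

definition linear_code :: "nat \<Rightarrow> nat \<Rightarrow> 'b::{finite,field} vec set \<Rightarrow> bool" where
  "linear_code n k C \<longleftrightarrow>
     subspace class_ring C (module_vec TYPE('b) n) \<and>
     vectorspace.dim class_ring ((module_vec TYPE('b) n)\<lparr>carrier := C\<rparr>) = k"

text \<open>The complement is taken for the bilinear form \<open>\<Sum>i. u\<^sub>i w\<^sub>i\<close>, without conjugation.\<close>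

definition dual_code :: "nat \<Rightarrow> 'b::{finite,field} vec set \<Rightarrow> 'b vec set" where
  "dual_code n C = vec_module.orthogonal_complement n C"

definition lcd_code :: "nat \<Rightarrow> 'b::{finite,field} vec set \<Rightarrow> bool" where
  "lcd_code n C \<longleftrightarrow> C \<inter> dual_code n C = {0\<^sub>v n}"

end

(*
  Writing a codeword of C as (a, a P), the code is LCD iff I + P P^T is nonsingular. Identify vectors
  indexed by F = GF(r^m) with elements of the group algebra GF(q)[F, +]. Then P acts as
  multiplication by g = sum_x phi(x) [x] and P P^T as multiplication by phi(-1) g^2, so a kernel
  vector is an h with g^2 h = d h, where d = -phi(-1) satisfies d^2 = 1. The Frobenius map
  evaluates g^(p^s) and yields a second relation for h.
  If N | p^s - 1, then g^(p^s) = phi(p^s)^(-1) g. Comparing with g^(2 p^s) h = d h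
  gives phi(p^(2s)) h = h.
  If N | p^s + 1, then g^(p^s) = phi(p^s) g', where g' belongs to the inverse character. As for
  Gauss sums, g g' = phi(-1) (r^m - sum_x [x]), and sum_x [x] kills h because it kills g. Hence
  h = g^(2 (p^s + 1)) h = phi(p^(2s)) r^(2m) h.
*)
theory Submission
  imports
    Defs
    "Jordan_Normal_Form.DL_Rank"
    "HOL-Library.Poly_Mapping"
    "HOL-Number_Theory.Residues"
begin

section \<open>Group algebras\<close>

text \<open>Scalars sit at index 0, so a natural number vanishes in the group algebra exactly when
  it vanishes among the coefficients. This makes the Frobenius map additive there.\<close>

lemma CHAR_poly_mapping: "CHAR('a::comm_monoid_add \<Rightarrow>\<^sub>0 'b::comm_semiring_1) = CHAR('b)"
proof (rule CHAR_eqI)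
  show "of_nat CHAR('b) = (0 :: 'a \<Rightarrow>\<^sub>0 'b)"
    by (simp flip: single_of_nat)
  show "CHAR('b) dvd n" if "of_nat n = (0 :: 'a \<Rightarrow>\<^sub>0 'b)" for n
  proof -
    have "(of_nat n :: 'b) = Poly_Mapping.lookup (of_nat n :: 'a \<Rightarrow>\<^sub>0 'b) 0"
      by (simp add: lookup_of_nat)
    then show ?thesis
      using that by (simp add: of_nat_eq_0_iff_char_dvd)
  qed
qed

lemma lookup_mult_finite:
  fixes f g :: "'a::{finite,ab_group_add} \<Rightarrow>\<^sub>0 'b::comm_semiring_1"
  shows "Poly_Mapping.lookup (f * g) z
       = (\<Sum>x\<in>UNIV. Poly_Mapping.lookup f x * Poly_Mapping.lookup g (z - x))"
proof -
  have *: "(z = x + y) = (y = z - x)" for x y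
    by (auto simp: algebra_simps)
  show ?thesis
    by (simp add: lookup_mult * Sum_any.expand_superset[of UNIV])
qed

text \<open>The basis element at index 0 is the unit of the group algebra, so
  \<open>Poly_Mapping.single 0 c\<close> plays the part of the scalar \<open>c\<close>
  throughout.\<close>

lemma lookup_single_zero_mult:
  fixes f :: "'a::{finite,ab_group_add} \<Rightarrow>\<^sub>0 'b::comm_semiring_1"
  shows "Poly_Mapping.lookup (Poly_Mapping.single 0 c * f) z = c * Poly_Mapping.lookup f z"
proof -
  have "Poly_Mapping.lookup (Poly_Mapping.single 0 c * f) z
      = (\<Sum>x\<in>UNIV. if x = (0 :: 'a) then c * Poly_Mapping.lookup f z else 0)"
    unfolding lookup_mult_finite by (intro sum.cong) (auto simp: lookup_single when_def)
  then show ?thesis by simp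
qed

text \<open>A group algebra has zero divisors in general, so cancellation is done coefficientwise
  and for scalars only. Both vanishing results for \<open>h\<close> end with this.\<close>

lemma single_zero_mult_cancel:
  fixes f :: "'a::{finite,ab_group_add} \<Rightarrow>\<^sub>0 'b::idom"
  assumes "Poly_Mapping.single 0 c * f = Poly_Mapping.single 0 d * f" and "c \<noteq> d"
  shows "f = 0"
proof (rule poly_mapping_eqI)
  fix z
  have "c * Poly_Mapping.lookup f z = d * Poly_Mapping.lookup f z"
    by (metis assms(1) lookup_single_zero_mult)
  with \<open>c \<noteq> d\<close> show "Poly_Mapping.lookup f z = Poly_Mapping.lookup 0 z"
    by simp
qed

lemma single_zero_power:
  fixes c :: "'b::comm_semiring_1"
  shows "Poly_Mapping.single (0 :: 'a::comm_monoid_add) c ^ n = Poly_Mapping.single 0 (c ^ n)"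
  by (induction n) (auto simp: mult_single)

lemma single_power:
  fixes x :: "'a::comm_semiring_1" and c :: "'b::comm_semiring_1"
  shows "Poly_Mapping.single x c ^ n = Poly_Mapping.single (of_nat n * x) (c ^ n)"
  by (induction n) (auto simp: mult_single distrib_right)

text \<open>The formal sum of all f(x) [x]. For a character it is a Gauss sum with the additive
  character left formal.\<close>

definition group_algebra_of :: "('a::finite \<Rightarrow> 'b::comm_monoid_add) \<Rightarrow> 'a \<Rightarrow>\<^sub>0 'b" where
  "group_algebra_of f = (\<Sum>x\<in>UNIV. Poly_Mapping.single x (f x))"

lemma lookup_group_algebra_of [simp]: "Poly_Mapping.lookup (group_algebra_of f) x = f x"
  by (simp add: group_algebra_of_def lookup_sum lookup_single when_def)

lemma group_algebra_of_eq_iff: "group_algebra_of f = g \<longleftrightarrow> (\<forall>x. f x = Poly_Mapping.lookup g x)"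
  by (auto simp: poly_mapping_eq_iff fun_eq_iff)

text \<open>In characteristic p a p^s-th power of a sum is taken termwise, and the n-th power of the
  basis element [x] is [n x].\<close>

lemma group_algebra_of_frobenius:
  fixes f :: "'a::{finite,comm_ring_1} \<Rightarrow> 'b::comm_ring_1"
  assumes "prime CHAR('b)" and "n = CHAR('b) ^ s"
  shows "group_algebra_of f ^ n = (\<Sum>x\<in>UNIV. Poly_Mapping.single (of_nat n * x) (f x ^ n))"
  unfolding group_algebra_of_def single_power[symmetric]
  by (rule freshmans_dream_sum') (use assms in \<open>simp_all add: CHAR_poly_mapping\<close>)

section \<open>Multiplicative characters\<close>

text \<open>Extension by 0 at the argument 0 lets all character sums range over the whole
  field.\<close>

locale mult_character =
  fixes \<chi> :: "'a::{finite,field} \<Rightarrow> 'b::field"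
  assumes zero [simp]: "\<chi> 0 = 0"
    and one [simp]: "\<chi> 1 = 1"
    and mult: "\<chi> (x * y) = \<chi> x * \<chi> y"
begin

lemma nonzero: "x \<noteq> 0 \<Longrightarrow> \<chi> x \<noteq> 0"
  by (metis mult mult_zero_left one right_inverse zero_neq_one)

lemma inverse: "\<chi> (inverse x) = inverse (\<chi> x)"
proof (cases "x = 0")
  case False
  then have "\<chi> x * \<chi> (inverse x) = 1"
    by (simp flip: mult)
  then show ?thesis
    by (metis inverse_unique)
qed simp

lemma divide: "\<chi> (x / y) = \<chi> x / \<chi> y"
  by (simp add: divide_inverse mult inverse)

lemma power: "\<chi> (x ^ n) = \<chi> x ^ n"
  by (induction n) (simp_all add: mult)

lemma minus_one_square: "\<chi> (- 1) * \<chi> (- 1) = 1"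
  by (simp flip: mult)

lemma minus: "\<chi> (- x) = \<chi> (- 1) * \<chi> x"
  by (simp flip: mult)

text \<open>The convention \<open>inverse 0 = 0\<close> preserves the value at 0.\<close>

lemma mult_character_inverse: "mult_character (\<lambda>x. inverse (\<chi> x))"
  by unfold_locales (simp_all add: mult)

text \<open>Substituting x / c for x pulls out a constant factor, as when a Galois automorphism acts
  on a Gauss sum.\<close>

lemma sum_single_scaled:
  assumes "c \<noteq> 0"
  shows "(\<Sum>x\<in>UNIV. Poly_Mapping.single (c * x) (\<chi> x))
       = Poly_Mapping.single 0 (inverse (\<chi> c)) * group_algebra_of \<chi>"
proof -
  have "(\<Sum>x\<in>UNIV. Poly_Mapping.single (c * x) (\<chi> x))
      = (\<Sum>x\<in>UNIV. Poly_Mapping.single x (inverse (\<chi> c) * \<chi> x))"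
    by (rule sum.reindex_bij_witness[of _ "\<lambda>x. x / c" "\<lambda>x. c * x"])
       (use assms nonzero[OF assms] in \<open>simp_all add: mult flip: mult.assoc\<close>)
  also have "\<dots> = Poly_Mapping.single 0 (inverse (\<chi> c)) * group_algebra_of \<chi>"
    by (simp add: group_algebra_of_def sum_distrib_left mult_single)
  finally show ?thesis .
qed

text \<open>Multiplication by \<open>a\<close> permutes the field, so the sum is fixed by the factor
  \<open>\<chi> a\<close>, which differs from 1.\<close>

lemma sum_eq_0:
  assumes "a \<noteq> 0" "\<chi> a \<noteq> 1"
  shows "(\<Sum>x\<in>UNIV. \<chi> x) = 0"
proof -
  have "\<chi> a * (\<Sum>x\<in>UNIV. \<chi> x) = (\<Sum>x\<in>UNIV. \<chi> (a * x))"
    by (simp add: sum_distrib_left mult)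
  also have "\<dots> = (\<Sum>x\<in>UNIV. \<chi> x)"
    by (rule sum.reindex_bij_witness[of _ "\<lambda>x. x / a" "\<lambda>x. a * x"]) (use assms in auto)
  finally show ?thesis
    using assms by simp
qed

text \<open>The Moebius map taking x to x / (z - x) is a bijection from the field without z to the
  field without -1. The sum is therefore a full character sum, which vanishes, minus the missing
  term.\<close>

lemma sum_quotient:
  assumes "a \<noteq> 0" "\<chi> a \<noteq> 1" "z \<noteq> 0"
  shows "(\<Sum>x\<in>UNIV. \<chi> x * inverse (\<chi> (z - x))) = - \<chi> (- 1)"
proof -
  \<comment> \<open>The term at x = z is 0 because \<open>inverse (\<chi> 0) = 0\<close>.\<close>
  have "(\<Sum>x\<in>UNIV. \<chi> x * inverse (\<chi> (z - x))) = (\<Sum>x\<in>UNIV - {z}. \<chi> (x / (z - x)))"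
    by (rule sum.mono_neutral_cong_right) (auto simp: divide_inverse mult inverse)
  also have "\<dots> = (\<Sum>w\<in>UNIV - {- 1}. \<chi> w)"
  proof (rule sum.reindex_bij_witness[of _ "\<lambda>w. z * w / (1 + w)" "\<lambda>x. x / (z - x)"])
    fix w assume "w \<in> UNIV - {- 1 :: 'a}"
    then have w: "1 + w \<noteq> 0"
      by (auto simp: add_eq_0_iff)
    then have eq: "z - z * w / (1 + w) = z / (1 + w)"
      by (simp add: field_simps)
    show "z * w / (1 + w) / (z - z * w / (1 + w)) = w"
      unfolding eq using w assms(3) by simp
    show "z * w / (1 + w) \<in> UNIV - {z}"
      using eq w assms(3) by auto
  next
    fix x assume "x \<in> UNIV - {z}"
    then have x: "z - x \<noteq> 0" by simp
    then have eq: "1 + x / (z - x) = z / (z - x)"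
      by (simp add: field_simps)
    show "z * (x / (z - x)) / (1 + x / (z - x)) = x"
      unfolding eq using x assms(3) by simp
    show "x / (z - x) \<in> UNIV - {- 1}"
      using eq x assms(3) by auto
  qed simp
  also have "\<dots> = (\<Sum>w\<in>UNIV. \<chi> w) - \<chi> (- 1)"
    by (simp add: sum_diff1)
  finally show ?thesis
    using sum_eq_0[OF assms(1,2)] by simp
qed

lemma sum_opposite_quotient:
  "(\<Sum>x\<in>UNIV. \<chi> x * inverse (\<chi> (- x))) = \<chi> (- 1) * (of_nat CARD('a) - 1)"
proof -
  have "(\<Sum>x\<in>UNIV. \<chi> x * inverse (\<chi> (- x))) = (\<Sum>x\<in>UNIV - {0 :: 'a}. \<chi> (- 1))"
  proof (rule sum.mono_neutral_cong_right)
    show "\<chi> x * inverse (\<chi> (- x)) = \<chi> (- 1)" if "x \<in> UNIV - {0}" for x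
    proof -
      have "\<chi> x * inverse (\<chi> (- x)) = \<chi> (x / - x)"
        by (simp only: divide divide_inverse[of "\<chi> x"])
      then show ?thesis using that by simp
    qed
  qed auto
  also have "\<dots> = \<chi> (- 1) * (of_nat CARD('a) - 1)"
    by (simp add: card_Diff_singleton of_nat_diff Suc_leI mult.commute)
  finally show ?thesis .
qed

text \<open>The formal counterpart of the product of the Gauss sums of a character and its inverse.
  The two preceding sums are its coefficients away from 0 and at 0.\<close>

lemma group_algebra_of_mult_inverse:
  assumes "a \<noteq> 0" "\<chi> a \<noteq> 1"
  shows "group_algebra_of \<chi> * group_algebra_of (\<lambda>x. inverse (\<chi> x))
       = Poly_Mapping.single 0 (\<chi> (- 1) * of_nat CARD('a)) - group_algebra_of (\<lambda>_. \<chi> (- 1))"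
proof (rule poly_mapping_eqI)
  fix z
  show "Poly_Mapping.lookup (group_algebra_of \<chi> * group_algebra_of (\<lambda>x. inverse (\<chi> x))) z =
    Poly_Mapping.lookup (Poly_Mapping.single 0 (\<chi> (- 1) * of_nat CARD('a))
        - group_algebra_of (\<lambda>_. \<chi> (- 1))) z"
    using sum_quotient[OF assms, of z] sum_opposite_quotient
    by (cases "z = 0")
       (simp_all add: lookup_mult_finite lookup_minus lookup_single right_diff_distrib)
qed

text \<open>Every coefficient of the product is \<open>c\<close> times the full character
  sum.\<close>

lemma group_algebra_of_mult_const:
  assumes "a \<noteq> 0" "\<chi> a \<noteq> 1"
  shows "group_algebra_of \<chi> * group_algebra_of (\<lambda>_. c) = 0"
  by (rule poly_mapping_eqI)
     (simp add: lookup_mult_finite sum_eq_0[OF assms] flip: sum_distrib_right)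

section \<open>Solutions of the kernel equation in the group algebra\<close>

context
  fixes p s :: nat and h :: "'a \<Rightarrow>\<^sub>0 'b"
  assumes p: "prime p" "CHAR('b) = p" "of_nat p \<noteq> (0 :: 'a)"
    and eigen: "h + Poly_Mapping.single 0 (\<chi> (- 1)) * group_algebra_of \<chi> ^ 2 * h = 0"
begin

text \<open>\<open>\<chi> (- 1)\<close> is its own inverse, so it can be moved across the kernel
  equation.\<close>

lemma eigen': "group_algebra_of \<chi> ^ 2 * h = Poly_Mapping.single 0 (- \<chi> (- 1)) * h"
proof -
  let ?e = "Poly_Mapping.single (0 :: 'a) (\<chi> (- 1))"
  have "?e * ?e = 1"
    by (simp add: mult_single minus_one_square)
  then have "group_algebra_of \<chi> ^ 2 * h = ?e * (?e * group_algebra_of \<chi> ^ 2 * h)"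
    by (simp flip: mult.assoc)
  also have "?e * group_algebra_of \<chi> ^ 2 * h = - h"
    using eigen by (simp add: add_eq_0_iff)
  finally show ?thesis
    by (simp add: single_uminus)
qed

lemma eigen_power:
  "(group_algebra_of \<chi> ^ 2) ^ n * h = Poly_Mapping.single 0 ((- \<chi> (- 1)) ^ n) * h"
proof (induction n)
  case (Suc n)
  have "(group_algebra_of \<chi> ^ 2) ^ Suc n * h = group_algebra_of \<chi> ^ 2 * ((group_algebra_of \<chi> ^ 2) ^ n * h)"
    by (simp only: power_Suc mult.assoc)
  also have "\<dots> = Poly_Mapping.single 0 ((- \<chi> (- 1)) ^ n) * (group_algebra_of \<chi> ^ 2 * h)"
    by (simp only: Suc.IH mult.left_commute)
  also have "\<dots> = Poly_Mapping.single 0 ((- \<chi> (- 1)) ^ Suc n) * h"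
    by (simp only: eigen' mult_single power_Suc2 add_0 flip: mult.assoc)
  finally show ?case .
qed simp

text \<open>The eigenvalue squares to 1, so odd powers fix it. For p = 2 it equals 1, since then -1
  = 1.\<close>

lemma eigenvalue_power: "(- \<chi> (- 1)) ^ (p ^ s) = - \<chi> (- 1)"
proof (cases "p = 2")
  case True
  have "\<chi> (- 1) = 1 \<or> \<chi> (- 1) = - 1"
    using minus_one_square by (simp add: square_eq_1_iff)
  moreover have "- 1 = (1 :: 'b)"
    using True p(2) by (simp add: uminus_CHAR_2)
  ultimately have "- \<chi> (- 1) = 1" by auto
  then show ?thesis by (simp only: power_one)
next
  case False
  then have "odd (p ^ s)"
    using p(1) prime_odd_nat prime_ge_2_nat[OF p(1)] by simp
  then obtain k where "p ^ s = 2 * k + 1"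
    by (elim oddE)
  then show ?thesis
    by (simp add: power_add power_mult power2_eq_square minus_one_square)
qed

text \<open>Raising g^2 to the power p^s multiplies it by a scalar \<open>e\<close>, while on
  \<open>h\<close> this power acts as the eigenvalue itself. Comparison gives e h = h, and the
  second hypothesis says that \<open>e\<close> is not 1.\<close>

lemma eq_0_if_power_eq_self:
  assumes "\<And>x. x \<noteq> 0 \<Longrightarrow> \<chi> x ^ (p ^ s) = \<chi> x" and "\<chi> (of_nat p) ^ (2 * s) \<noteq> 1"
  shows "h = 0"
proof -
  have nz: "of_nat (p ^ s) \<noteq> (0 :: 'a)"
    using p(3) by simp
  have p0: "p ^ s \<noteq> 0"
    using p(1) by auto
  define e where "e = inverse (\<chi> (of_nat (p ^ s))) ^ 2"
  have "group_algebra_of \<chi> ^ (p ^ s) = (\<Sum>x\<in>UNIV. Poly_Mapping.single (of_nat (p ^ s) * x) (\<chi> x ^ (p ^ s)))"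
    by (rule group_algebra_of_frobenius) (use p in auto)
  \<comment> \<open>The hypothesis covers nonzero x only; at x = 0 both values are 0 because the
    exponent is positive.\<close>
  also have "\<dots> = (\<Sum>x\<in>UNIV. Poly_Mapping.single (of_nat (p ^ s) * x) (\<chi> x))"
    by (intro sum.cong refl arg_cong2[where f = Poly_Mapping.single])
       (metis assms(1) p0 zero zero_power2 power_0_left)
  also have "\<dots> = Poly_Mapping.single 0 (inverse (\<chi> (of_nat (p ^ s)))) * group_algebra_of \<chi>"
    by (rule sum_single_scaled[OF nz])
  finally have frob: "group_algebra_of \<chi> ^ (p ^ s)
      = Poly_Mapping.single 0 (inverse (\<chi> (of_nat (p ^ s)))) * group_algebra_of \<chi>" .
  have "(group_algebra_of \<chi> ^ 2) ^ (p ^ s) = (group_algebra_of \<chi> ^ (p ^ s)) ^ 2"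
    by (simp only: mult.commute flip: power_mult)
  also have "\<dots> = Poly_Mapping.single 0 e * group_algebra_of \<chi> ^ 2"
    by (simp only: frob power_mult_distrib single_zero_power e_def)
  finally have "(group_algebra_of \<chi> ^ 2) ^ (p ^ s) = Poly_Mapping.single 0 e * group_algebra_of \<chi> ^ 2" .
  then have "Poly_Mapping.single 0 (- \<chi> (- 1)) * h
      = Poly_Mapping.single 0 e * (group_algebra_of \<chi> ^ 2 * h)"
    using eigen_power[of "p ^ s"] by (simp add: eigenvalue_power mult.assoc)
  also have "\<dots> = Poly_Mapping.single 0 (e * - \<chi> (- 1)) * h"
    by (simp add: eigen' mult_single flip: mult.assoc)
  finally have eq: "Poly_Mapping.single 0 (- \<chi> (- 1)) * h = Poly_Mapping.single 0 (e * - \<chi> (- 1)) * h" .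
  have "e = inverse (\<chi> (of_nat p) ^ (2 * s))"
    by (simp add: e_def power power_inverse mult.commute[of 2 s] flip: power_mult)
  with assms(2) have "e \<noteq> 1"
    by simp
  then have "- \<chi> (- 1) \<noteq> e * - \<chi> (- 1)"
    using minus_one_square by auto
  with eq show ?thesis
    by (rule single_zero_mult_cancel)
qed

text \<open>The Frobenius power of g is now a multiple of \<open>?g'\<close>, so g^(p^s + 1) acts on
  \<open>h\<close> through the Gauss sum product, that is, as a scalar. Its square also acts as 1,
  and the last hypothesis keeps the two scalars apart.\<close>

lemma eq_0_if_power_eq_inverse:
  assumes "a \<noteq> 0" "\<chi> a \<noteq> 1"
    and "\<And>x. x \<noteq> 0 \<Longrightarrow> \<chi> x ^ (p ^ s) = inverse (\<chi> x)"
    and "\<chi> (of_nat p) ^ (2 * s) * of_nat CARD('a) ^ 2 \<noteq> 1"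
  shows "h = 0"
proof -
  interpret inv: mult_character "\<lambda>x. inverse (\<chi> x)"
    by (rule mult_character_inverse)
  have nz: "of_nat (p ^ s) \<noteq> (0 :: 'a)"
    using p(3) by simp
  have p0: "p ^ s \<noteq> 0"
    using p(1) by auto
  let ?g = "group_algebra_of \<chi>" and ?g' = "group_algebra_of (\<lambda>x. inverse (\<chi> x))"
  let ?u = "\<chi> (of_nat (p ^ s))" and ?w = "\<chi> (- 1) * of_nat CARD('a)"
  have "?g ^ (p ^ s) = (\<Sum>x\<in>UNIV. Poly_Mapping.single (of_nat (p ^ s) * x) (\<chi> x ^ (p ^ s)))"
    by (rule group_algebra_of_frobenius) (use p in auto)
  also have "\<dots> = (\<Sum>x\<in>UNIV. Poly_Mapping.single (of_nat (p ^ s) * x) (inverse (\<chi> x)))"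
    by (intro sum.cong refl arg_cong2[where f = Poly_Mapping.single])
       (metis assms(3) p0 zero inverse_zero power_0_left)
  \<comment> \<open>The scaling rule is applied to the inverse character, so its factor is a double
    inverse, namely \<open>?u\<close>.\<close>
  also have "\<dots> = Poly_Mapping.single 0 ?u * ?g'"
    using inv.sum_single_scaled[OF nz] by simp
  finally have frob: "?g ^ (p ^ s) = Poly_Mapping.single 0 ?u * ?g'" .
  have d2: "(- \<chi> (- 1)) * (- \<chi> (- 1)) = 1"
    by (simp add: minus_one_square)
  \<comment> \<open>This exhibits \<open>h\<close> as g^4 h. Being a multiple of g, it is
    annihilated by the constant functions.\<close>
  have "h = Poly_Mapping.single 0 ((- \<chi> (- 1)) ^ 2) * h"
    by (simp add: power2_eq_square minus_one_square)
  also have "\<dots> = (?g ^ 2) ^ 2 * h"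
    by (rule eigen_power[symmetric])
  finally have h: "h = (?g ^ 2) ^ 2 * h" .
  have "group_algebra_of (\<lambda>_. c) * h = 0" for c
  proof -
    have "group_algebra_of (\<lambda>_. c) * h = group_algebra_of (\<lambda>_. c) * ((?g ^ 2) ^ 2 * h)"
      using h by simp
    also have "\<dots> = ?g * group_algebra_of (\<lambda>_. c) * (?g ^ 3 * h)"
      by (simp add: eval_nat_numeral mult_ac)
    finally show ?thesis
      by (simp add: group_algebra_of_mult_const[OF assms(1,2)])
  qed
  then have gg': "?g * ?g' * h = Poly_Mapping.single 0 ?w * h"
    by (simp add: group_algebra_of_mult_inverse[OF assms(1,2)] left_diff_distrib)
  \<comment> \<open>The eigenvalue is unchanged by the power p^s, so one further factor makes its
    square, which is 1.\<close>
  have "h = Poly_Mapping.single 0 ((- \<chi> (- 1)) ^ (p ^ s + 1)) * h"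
    using d2 by (simp add: power_add eigenvalue_power)
  also have "\<dots> = (?g ^ 2) ^ (p ^ s + 1) * h"
    by (rule eigen_power[symmetric])
  also have "\<dots> = (?g * ?g ^ (p ^ s)) ^ 2 * h"
    by (simp add: power_add power_mult_distrib mult_ac flip: power_mult)
  also have "\<dots> = Poly_Mapping.single 0 (?u ^ 2) * (?g * ?g' * (?g * ?g' * h))"
    unfolding frob single_zero_power[symmetric] by (simp only: power2_eq_square mult_ac)
  also have "?g * ?g' * (?g * ?g' * h) = Poly_Mapping.single 0 ?w * (?g * ?g' * h)"
    by (subst gg') (rule mult.left_commute)
  also have "Poly_Mapping.single 0 (?u ^ 2) * \<dots> = Poly_Mapping.single 0 (?u ^ 2 * ?w ^ 2) * h"
    unfolding gg' by (simp add: mult_single power2_eq_square mult.assoc flip: mult.assoc[of "Poly_Mapping.single 0 _"])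
  finally have "Poly_Mapping.single 0 1 * h = Poly_Mapping.single 0 (?u ^ 2 * ?w ^ 2) * h"
    by simp
  moreover have "?u ^ 2 * ?w ^ 2 = \<chi> (of_nat p) ^ (2 * s) * of_nat CARD('a) ^ 2"
    using minus_one_square
    by (simp add: power power_mult_distrib power2_eq_square[of "\<chi> (- 1)"] mult.commute[of 2 s]
        flip: power_mult)
  ultimately show ?thesis
    using single_zero_mult_cancel assms(4) by metis
qed

end

end

section \<open>Systematic generator matrices\<close>

text \<open>The lower blocks have no rows, so only the upper left block of the product
  survives.\<close>

lemma four_block_one_mult_transpose:
  fixes P :: "'b::comm_ring_1 mat"
  assumes P: "P \<in> carrier_mat k l"
  defines "G \<equiv> four_block_mat (1\<^sub>m k) P (0\<^sub>m 0 k) (0\<^sub>m 0 l)"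
  shows "G \<in> carrier_mat k (k + l)" and "G * G\<^sup>T = 1\<^sub>m k + P * P\<^sup>T"
proof -
  show "G \<in> carrier_mat k (k + l)"
    unfolding G_def using P by auto
  have "G\<^sup>T = four_block_mat (1\<^sub>m k) (0\<^sub>m k 0) P\<^sup>T (0\<^sub>m l 0)"
    unfolding G_def by (subst transpose_four_block_mat[OF one_carrier_mat P zero_carrier_mat zero_carrier_mat]) simp
  then have "G * G\<^sup>T = four_block_mat (1\<^sub>m k * 1\<^sub>m k + P * P\<^sup>T) (1\<^sub>m k * 0\<^sub>m k 0 + P * 0\<^sub>m l 0)
      (0\<^sub>m 0 k * 1\<^sub>m k + 0\<^sub>m 0 l * P\<^sup>T) (0\<^sub>m 0 k * 0\<^sub>m k 0 + 0\<^sub>m 0 l * 0\<^sub>m l 0)"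
    unfolding G_def
    by (simp only:) (rule mult_four_block_mat[OF one_carrier_mat P zero_carrier_mat zero_carrier_mat
          one_carrier_mat zero_carrier_mat transpose_carrier_mat[THEN iffD2, OF P] zero_carrier_mat])
  also have "\<dots> = 1\<^sub>m k + P * P\<^sup>T"
    using P by (intro eq_matI) auto
  finally show "G * G\<^sup>T = 1\<^sub>m k + P * P\<^sup>T" .
qed

text \<open>The rows of G are the columns of its transpose, whose trivial kernel makes them
  independent; the dimension is then the number of rows.\<close>

lemma linear_code_row_space:
  fixes G :: "'b::{finite,field} mat"
  assumes G: "G \<in> carrier_mat k n"
    and inj: "\<And>y. y \<in> carrier_vec k \<Longrightarrow> G\<^sup>T *\<^sub>v y = 0\<^sub>v n \<Longrightarrow> y = 0\<^sub>v k"
  shows "linear_code n k (vec_space.row_space n G)"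
proof -
  interpret vec_space "TYPE('b)" n .
  have GT: "G\<^sup>T \<in> carrier_mat n k"
    using G by simp
  have rows: "set (rows G) \<subseteq> carrier_vec n"
    using G rows_carrier[of G] by auto
  have col_eq: "col G\<^sup>T i = G\<^sup>T *\<^sub>v unit_vec k i" if "i < k" for i
    using that GT by (intro eq_vecI) auto
  \<comment> \<open>Independence is a property of the set of columns, so repetitions are excluded
    separately: two equal columns would put a difference of unit vectors into the kernel.\<close>
  have "distinct (cols G\<^sup>T)"
    unfolding distinct_conv_nth
  proof (intro allI impI notI)
    fix i j assume ij: "i < length (cols G\<^sup>T)" "j < length (cols G\<^sup>T)" "i \<noteq> j"
      and eq: "cols G\<^sup>T ! i = cols G\<^sup>T ! j"
    have i: "i < k" and j: "j < k" using ij G by auto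
    have "G\<^sup>T *\<^sub>v unit_vec k i = G\<^sup>T *\<^sub>v unit_vec k j"
      using eq i j G by (simp flip: col_eq)
    then have "G\<^sup>T *\<^sub>v (unit_vec k i - unit_vec k j) = 0\<^sub>v n"
      using GT by (simp add: mult_minus_distrib_mat_vec[OF GT])
    then have "unit_vec k i - unit_vec k j = (0\<^sub>v k :: 'b vec)"
      by (intro inj) auto
    then have "(unit_vec k i - unit_vec k j) $ i = (0\<^sub>v k :: 'b vec) $ i"
      by simp
    with i j \<open>i \<noteq> j\<close> show False by simp
  qed
  moreover have "lin_indpt (set (cols G\<^sup>T))"
    using lin_depE[OF GT _ \<open>distinct (cols G\<^sup>T)\<close>] inj by metis
  ultimately have "rank G\<^sup>T = k"
    by (intro lin_indpt_full_rank[OF GT])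
  moreover have "VectorSpace.subspace class_ring (span (set (rows G))) V"
    by (rule span_is_subspace) (use rows in simp)
  ultimately show ?thesis
    unfolding linear_code_def rank_def row_space_def by simp
qed

text \<open>One direction of Massey's criterion. A codeword is the image of some y under the
  transpose of G; if it is orthogonal to every row, then G G^T kills y.\<close>

lemma lcd_code_row_space:
  fixes G :: "'b::{finite,field} mat"
  assumes G: "G \<in> carrier_mat k n"
    and inj: "\<And>y. y \<in> carrier_vec k \<Longrightarrow> (G * G\<^sup>T) *\<^sub>v y = 0\<^sub>v k \<Longrightarrow> y = 0\<^sub>v k"
  shows "lcd_code n (vec_space.row_space n G)"
proof -
  interpret vec_space "TYPE('b)" n .
  have GT: "G\<^sup>T \<in> carrier_mat n k"
    using G by simp
  have rs: "row_space G = {w \<in> carrier_vec n. \<exists>y\<in>carrier_vec k. G\<^sup>T *\<^sub>v y = w}"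
    using row_space_eq[OF G] G by auto
  have "w = 0\<^sub>v n" if w: "w \<in> row_space G" "w \<in> orthogonal_complement (row_space G)" for w
  proof -
    obtain y where y: "y \<in> carrier_vec k" "G\<^sup>T *\<^sub>v y = w" and wn: "w \<in> carrier_vec n"
      using w(1) rs by auto
    have "G *\<^sub>v w = 0\<^sub>v k"
    proof (rule eq_vecI)
      fix i assume "i < dim_vec (0\<^sub>v k :: 'b vec)"
      then have i: "i < k" by simp
      have "row G i = G\<^sup>T *\<^sub>v unit_vec k i"
        using i G by (intro eq_vecI) auto
      then have "row G i \<in> row_space G"
        using rs i G by auto
      then have "w \<bullet> row G i = 0"
        using w(2) by (auto simp: orthogonal_complement_def)
      then show "(G *\<^sub>v w) $ i = 0\<^sub>v k $ i"
        using i G wn comm_scalar_prod[OF wn, of "row G i"] by auto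
    qed (use G in auto)
    then have "(G * G\<^sup>T) *\<^sub>v y = 0\<^sub>v k"
      using y G by (simp add: assoc_mult_mat_vec[OF G GT])
    with y(1) have "y = 0\<^sub>v k"
      by (rule inj)
    with y(2) GT show ?thesis by auto
  qed
  moreover have "0\<^sub>v n \<in> row_space G"
    unfolding rs using GT by (auto intro!: bexI[of _ "0\<^sub>v k"])
  moreover have "0\<^sub>v n \<in> orthogonal_complement (row_space G)"
    using rs by (auto simp: orthogonal_complement_def)
  ultimately show ?thesis
    unfolding lcd_code_def dual_code_def by blast
qed

text \<open>One hypothesis serves both claims, because the kernel of G^T lies in the kernel of G
  G^T.\<close>

lemma char_code_linear_lcd:
  fixes \<phi> :: "'a::{finite,field} \<Rightarrow> 'b::{finite,field}"
  assumes inj: "\<And>y. y \<in> carrier_vec CARD('a) \<Longrightarrow>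
      (1\<^sub>m CARD('a) + P_mat \<phi> v x * (P_mat \<phi> v x)\<^sup>T) *\<^sub>v y = 0\<^sub>v CARD('a) \<Longrightarrow> y = 0\<^sub>v CARD('a)"
  shows "linear_code (2 * CARD('a)) CARD('a) (char_code \<phi> v x)"
    and "lcd_code (2 * CARD('a)) (char_code \<phi> v x)"
proof -
  let ?k = "CARD('a)" and ?G = "gen_mat \<phi> v x"
  have P: "P_mat \<phi> v x \<in> carrier_mat ?k ?k"
    by (simp add: P_mat_def)
  have G: "?G \<in> carrier_mat ?k (2 * ?k)"
    and GGT: "?G * ?G\<^sup>T = 1\<^sub>m ?k + P_mat \<phi> v x * (P_mat \<phi> v x)\<^sup>T"
    using four_block_one_mult_transpose[OF P] by (simp_all add: gen_mat_def mult_2)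
  have inj': "y = 0\<^sub>v ?k" if "y \<in> carrier_vec ?k" "(?G * ?G\<^sup>T) *\<^sub>v y = 0\<^sub>v ?k" for y
    using inj that by (simp add: GGT)
  show "lcd_code (2 * ?k) (char_code \<phi> v x)"
    unfolding char_code_def by (rule lcd_code_row_space[OF G inj'])
  show "linear_code (2 * ?k) ?k (char_code \<phi> v x)"
    unfolding char_code_def
  proof (rule linear_code_row_space[OF G])
    fix y :: "'b vec" assume y: "y \<in> carrier_vec ?k" "?G\<^sup>T *\<^sub>v y = 0\<^sub>v (2 * ?k)"
    have "(?G * ?G\<^sup>T) *\<^sub>v y = ?G *\<^sub>v (?G\<^sup>T *\<^sub>v y)"
      by (rule assoc_mult_mat_vec[OF G _ y(1)]) (use G in simp)
    then show "y = 0\<^sub>v ?k"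
      using y G by (intro inj'[OF y(1)]) auto
  qed
qed

text \<open>Carries a kernel vector over to the group algebra: \<open>h\<close> is \<open>y\<close>
  reindexed by field elements. The transpose of P acts as convolution with \<chi>; P itself has the
  differences reversed, which costs the factor \<open>\<chi> (- 1)\<close>.\<close>

lemma char_code_eigen:
  fixes \<chi> :: "'a::{finite,field} \<Rightarrow> 'b::{finite,field}" and x :: "nat \<Rightarrow> 'a" and y :: "'b vec"
  assumes "mult_character \<chi>"
    and \<phi>: "\<And>z. z \<noteq> 0 \<Longrightarrow> \<phi> z = \<chi> z"
    and x: "bij_betw x {..<CARD('a)} UNIV"
    and y: "y \<in> carrier_vec CARD('a)"
    and eq: "(1\<^sub>m CARD('a) + P_mat \<phi> 0 x * (P_mat \<phi> 0 x)\<^sup>T) *\<^sub>v y = 0\<^sub>v CARD('a)"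
  defines "h \<equiv> group_algebra_of (\<lambda>z. y $ (the_inv_into {..<CARD('a)} x z))"
  shows "h + Poly_Mapping.single 0 (\<chi> (- 1)) * group_algebra_of \<chi> ^ 2 * h = 0"
proof -
  interpret mult_character \<chi> by fact
  let ?n = "CARD('a)" and ?P = "P_mat \<phi> 0 x"
  have inj: "inj_on x {..<?n}"
    using x by (rule bij_betw_imp_inj_on)
  have P: "?P \<in> carrier_mat ?n ?n"
    by (simp add: P_mat_def)
  \<comment> \<open>The diagonal value 0 agrees with \<open>\<chi> 0\<close>, so the case
    distinction in P disappears.\<close>
  have P_ij: "?P $$ (i, j) = \<chi> (x j - x i)" if "i < ?n" "j < ?n" for i j
    using that inj_onD[OF inj, of i j] by (auto simp: P_mat_def intro!: \<phi>)
  have hx: "Poly_Mapping.lookup h (x i) = y $ i" if "i < ?n" for i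
    using that by (simp add: h_def the_inv_into_f_f[OF inj])
  have conv: "Poly_Mapping.lookup (group_algebra_of \<chi> * f) z
      = (\<Sum>i<?n. \<chi> (z - x i) * Poly_Mapping.lookup f (x i))" for f z
  proof -
    have "Poly_Mapping.lookup (group_algebra_of \<chi> * f) z
        = (\<Sum>w\<in>UNIV. \<chi> (z - w) * Poly_Mapping.lookup f w)"
      unfolding lookup_mult_finite
      by (rule sum.reindex_bij_witness[of _ "\<lambda>w. z - w" "\<lambda>w. z - w"]) auto
    also have "\<dots> = (\<Sum>i<?n. \<chi> (z - x i) * Poly_Mapping.lookup f (x i))"
      by (rule sum.reindex_bij_betw[OF x, symmetric])
    finally show ?thesis .
  qed
  have PTy: "(?P\<^sup>T *\<^sub>v y) $ j = Poly_Mapping.lookup (group_algebra_of \<chi> * h) (x j)" if "j < ?n" for j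
    using that P y unfolding conv
    by (auto simp: scalar_prod_def hx P_ij atLeast0LessThan intro!: sum.cong)
  show ?thesis
  proof (rule poly_mapping_eqI)
    fix z
    obtain k where k: "k < ?n" "z = x k"
      using x by (auto simp: bij_betw_def)
    have minus': "\<chi> (x j - x k) = \<chi> (- 1) * \<chi> (x k - x j)" for j
      using minus[of "x k - x j"] by simp
    have "0 = ((1\<^sub>m ?n + ?P * ?P\<^sup>T) *\<^sub>v y) $ k"
      using k by (simp add: eq)
    also have "(1\<^sub>m ?n + ?P * ?P\<^sup>T) *\<^sub>v y = 1\<^sub>m ?n *\<^sub>v y + ?P *\<^sub>v (?P\<^sup>T *\<^sub>v y)"
      using P y by (simp add: add_mult_distrib_mat_vec[of _ ?n ?n] assoc_mult_mat_vec[of _ ?n ?n])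
    also have "\<dots> $ k = y $ k + (\<Sum>j<?n. \<chi> (x j - x k) * (?P\<^sup>T *\<^sub>v y) $ j)"
      using P y k by (auto simp: scalar_prod_def P_ij atLeast0LessThan intro!: sum.cong)
    also have "(\<Sum>j<?n. \<chi> (x j - x k) * (?P\<^sup>T *\<^sub>v y) $ j)
        = \<chi> (- 1) * Poly_Mapping.lookup (group_algebra_of \<chi> * (group_algebra_of \<chi> * h)) (x k)"
      unfolding conv[of "group_algebra_of \<chi> * h"]
      by (simp add: PTy minus' sum_distrib_left mult.assoc del: index_mult_mat_vec)
    finally show "Poly_Mapping.lookup (h + Poly_Mapping.single 0 (\<chi> (- 1)) * group_algebra_of \<chi> ^ 2 * h) z
        = Poly_Mapping.lookup 0 z"
      using k by (simp add: lookup_add lookup_single_zero_mult hx power2_eq_square mult.assoc)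
  qed
qed

section \<open>Finite fields\<close>

text \<open>The characteristic is a prime dividing the cardinality.\<close>

lemma CHAR_eq_if_CARD_prime_power:
  assumes "CARD('a::{finite,field}) = r ^ m" "prime r"
  shows "CHAR('a) = r"
proof -
  have "prime CHAR('a)"
    by (rule prime_CHAR_semidom) (simp add: finite_imp_CHAR_pos)
  moreover have "CHAR('a) dvd r ^ m"
    using CHAR_dvd_CARD[where ?'a = 'a] assms(1) by simp
  ultimately show ?thesis
    using assms(2) prime_dvd_power primes_dvd_imp_eq by blast
qed

text \<open>Multiplication by \<open>x\<close> permutes the nonzero elements; compare their
  products.\<close>

lemma power_CARD_minus_1:
  fixes x :: "'a::{finite,field}"
  assumes "x \<noteq> 0"
  shows "x ^ (CARD('a) - 1) = 1"
proof -
  have "(\<Prod>y\<in>UNIV - {0}. x * y) = \<Prod>(UNIV - {0})"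
    by (rule prod.reindex_bij_witness[of _ "\<lambda>y. y / x" "\<lambda>y. x * y"]) (use assms in auto)
  then have "x ^ (CARD('a) - 1) * \<Prod>(UNIV - {0 :: 'a}) = 1 * \<Prod>(UNIV - {0})"
    by (simp add: prod.distrib card_Diff_singleton)
  moreover have "\<Prod>(UNIV - {0 :: 'a}) \<noteq> 0"
    by simp
  ultimately show ?thesis
    by (metis mult_right_cancel)
qed

lemma two_le_CARD: "2 \<le> CARD('a::{finite,zero_neq_one})"
  using card_mono[of UNIV "{0, 1 :: 'a}"] by simp

lemma primitive_element_power_mod:
  fixes a :: "'a::{finite,field}"
  assumes "primitive_element a"
  shows "a ^ (k mod (CARD('a) - 1)) = a ^ k"
proof -
  have "a ^ k = a ^ ((CARD('a) - 1) * (k div (CARD('a) - 1)) + k mod (CARD('a) - 1))"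
    by simp
  also have "\<dots> = a ^ (k mod (CARD('a) - 1))"
    using assms power_CARD_minus_1[of a]
    by (simp only: power_add power_mult) (simp add: primitive_element_def)
  finally show ?thesis ..
qed

text \<open>The powers exhaust the nonzero elements, and there are exactly as many exponents as such
  elements.\<close>

lemma primitive_element_inj:
  fixes a :: "'a::{finite,field}"
  assumes "primitive_element a"
  shows "inj_on (\<lambda>k. a ^ k) {..CARD('a) - 2}"
proof (rule eq_card_imp_inj_on)
  have "(\<lambda>k. a ^ k) ` {..CARD('a) - 2} = UNIV - {0}"
  proof (intro equalityI subsetI)
    fix y assume "y \<in> UNIV - {0 :: 'a}"
    then obtain k where "y = a ^ k"
      using assms by (auto simp: primitive_element_def)
    then have "y = a ^ (k mod (CARD('a) - 1))"
      by (simp only: primitive_element_power_mod[OF assms])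
    moreover have "k mod (CARD('a) - 1) \<in> {..CARD('a) - 2}"
      using two_le_CARD[where ?'a = 'a] mod_less_divisor[of "CARD('a) - 1" k]
      unfolding atMost_iff by linarith
    ultimately show "y \<in> (\<lambda>k. a ^ k) ` {..CARD('a) - 2}"
      by blast
  qed (use assms in \<open>auto simp: primitive_element_def\<close>)
  then show "card ((\<lambda>k. a ^ k) ` {..CARD('a) - 2}) = card {..CARD('a) - 2}"
    using two_le_CARD[where ?'a = 'a] by (simp add: card_Diff_singleton)
qed simp

section \<open>The map \<open>phi\<close> as a multiplicative character\<close>

context
  fixes \<alpha> :: "'a::{finite,field}" and \<beta> :: "'b::{finite,field}" and N :: nat
  assumes prim: "primitive_element \<alpha>" "primitive_element \<beta>"
    and N: "N dvd CARD('a) - 1" "N dvd CARD('b) - 1"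
begin

lemma root_power: "(\<beta> ^ ((CARD('b) - 1) div N)) ^ N = 1"
  using prim(2) N(2) power_CARD_minus_1[of \<beta>]
  by (simp add: primitive_element_def flip: power_mult)

text \<open>Lifts the bound on the exponent in the definition: since N divides
  \<open>CARD('a) - 1\<close>, reducing the exponent modulo this number changes neither
  side.\<close>

lemma phi_power: "phi \<alpha> \<beta> N (\<alpha> ^ k) = (\<beta> ^ ((CARD('b) - 1) div N)) ^ k"
proof -
  let ?u = "\<beta> ^ ((CARD('b) - 1) div N)" and ?n = "CARD('a) - 1"
  have le: "k mod ?n \<le> CARD('a) - 2"
    using two_le_CARD[where ?'a = 'a] mod_less_divisor[of ?n k] by linarith
  have "(THE l. l \<le> CARD('a) - 2 \<and> \<alpha> ^ l = \<alpha> ^ k) = k mod ?n"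
  proof (rule the_equality)
    fix l assume "l \<le> CARD('a) - 2 \<and> \<alpha> ^ l = \<alpha> ^ k"
    then show "l = k mod ?n"
      using le primitive_element_power_mod[OF prim(1), of k]
      by (intro inj_onD[OF primitive_element_inj[OF prim(1)]]) auto
  qed (use le primitive_element_power_mod[OF prim(1)] in auto)
  then have "phi \<alpha> \<beta> N (\<alpha> ^ k) = ?u ^ (k mod ?n)"
    by (simp add: phi_def)
  also obtain d where "?n = N * d"
    using N(1) by blast
  then have "?u ^ ?n = 1"
    by (simp only: power_mult root_power power_one)
  then have "?u ^ (k mod ?n) = ?u ^ (?n * (k div ?n) + k mod ?n)"
    by (simp only: power_add power_mult power_one mult_1_left)
  finally show ?thesis by simp
qed

lemma mult_character_phi: "mult_character (\<lambda>x. if x = 0 then 0 else phi \<alpha> \<beta> N x)"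
proof
  have ex: "\<exists>k. x = \<alpha> ^ k" if "x \<noteq> 0" for x
    using prim(1) that by (auto simp: primitive_element_def)
  show "(if x * y = 0 then 0 else phi \<alpha> \<beta> N (x * y)) =
      (if x = 0 then 0 else phi \<alpha> \<beta> N x) * (if y = 0 then 0 else phi \<alpha> \<beta> N y)" for x y
    using ex[of x] ex[of y] by (auto simp: phi_power simp flip: power_add)
  show "(if (1 :: 'a) = 0 then 0 else phi \<alpha> \<beta> N 1) = 1"
    using phi_power[of 0] by simp
qed simp

lemma phi_power_order:
  assumes "x \<noteq> 0"
  shows "phi \<alpha> \<beta> N x ^ N = 1"
proof -
  obtain k where "x = \<alpha> ^ k"
    using prim(1) assms by (auto simp: primitive_element_def)
  have "phi \<alpha> \<beta> N x ^ N = ((\<beta> ^ ((CARD('b) - 1) div N)) ^ N) ^ k"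
    unfolding \<open>x = \<alpha> ^ k\<close> phi_power by (metis mult.commute power_mult)
  then show ?thesis
    by (simp only: root_power power_one)
qed

text \<open>The value is \<beta> raised to (q - 1) / N, with q the size of its field. For N > 1 this
  exponent lies strictly between 0 and q - 1, so the power is not 1.\<close>

lemma phi_nontrivial:
  assumes "N > 1"
  shows "phi \<alpha> \<beta> N \<alpha> \<noteq> 1"
proof
  let ?d = "(CARD('b) - 1) div N"
  assume "phi \<alpha> \<beta> N \<alpha> = 1"
  then have "\<beta> ^ ?d = \<beta> ^ 0"
    using phi_power[of 1] by simp
  moreover have "0 < CARD('b) - 1"
    using two_le_CARD[where ?'a = 'b] by linarith
  then have "0 < ?d" "?d < CARD('b) - 1"
    using N(2) assms by (auto simp: div_greater_zero_iff dvd_imp_le)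
  then have "0 < ?d" "?d \<le> CARD('b) - 2"
    by linarith+
  ultimately show False
    using inj_onD[OF primitive_element_inj[OF prim(2)], of ?d 0] by auto
qed

end

theorem theorem4p1:
  fixes r m N p e q :: nat
    and \<alpha> :: "'a::{finite,field}"
    and \<beta> :: "'b::{finite,field}"
    and x :: "nat \<Rightarrow> 'a"
    and \<phi> :: "'a \<Rightarrow> 'b"
    and C :: "'b vec set"
  assumes "prime r" and "m > 0" and "CARD('a) = r ^ m"
    and "N > 1" and "N dvd r ^ m - 1"
    and "prime p" and "e > 0" and "q = p ^ e" and "CARD('b) = q"
    and "gcd p r = 1" and "N dvd q - 1"
    and "primitive_element \<alpha>" and "primitive_element \<beta>"
    and "bij_betw x {..<r ^ m} UNIV"
  defines "\<phi> \<equiv> phi \<alpha> \<beta> N"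
    and "C \<equiv> char_code (phi \<alpha> \<beta> N) 0 x"
  shows "((\<exists>s>0. N dvd p ^ s - 1 \<and> \<phi> (of_nat (p ^ (2 * s))) \<noteq> 1)
            \<longrightarrow> linear_code (2 * r ^ m) (r ^ m) C \<and> lcd_code (2 * r ^ m) C)
       \<and> (\<phi> (of_nat (q ^ 2)) \<noteq> 1
            \<longrightarrow> linear_code (2 * r ^ m) (r ^ m) C \<and> lcd_code (2 * r ^ m) C)
       \<and> ((\<exists>s>0. N dvd p ^ s + 1 \<and> \<phi> (of_nat p powi (- 2 * int s)) \<noteq> of_nat (r ^ (2 * m)))
            \<longrightarrow> linear_code (2 * r ^ m) (r ^ m) C \<and> lcd_code (2 * r ^ m) C)"
proof -
  \<comment> \<open>\<open>\<phi>\<close> is only meaningful off 0, so it is replaced by its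
    extension by zero.\<close>
  define \<chi> where "\<chi> = (\<lambda>z. if z = 0 then 0 else \<phi> z)"
  have N: "N dvd CARD('a) - 1" "N dvd CARD('b) - 1"
    using assms by simp_all
  have \<phi>_\<chi>: "\<phi> z = \<chi> z" if "z \<noteq> 0" for z
    using that by (simp add: \<chi>_def)
  interpret mult_character \<chi>
    unfolding \<chi>_def \<phi>_def using mult_character_phi assms(12,13) N .
  have \<chi>_N: "\<chi> z ^ N = 1" if "z \<noteq> 0" for z
    using phi_power_order[OF assms(12,13) N that] that by (simp add: \<chi>_def \<phi>_def)
  have \<alpha>: "\<alpha> \<noteq> 0"
    using assms(12) by (simp add: primitive_element_def)
  then have \<chi>_\<alpha>: "\<chi> \<alpha> \<noteq> 1"
    using phi_nontrivial[OF assms(12,13) N assms(4)] by (simp add: \<chi>_def \<phi>_def)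
  have char_b: "CHAR('b) = p"
    using CHAR_eq_if_CARD_prime_power assms(6,8,9) by blast
  have char_a: "CHAR('a) = r"
    using CHAR_eq_if_CARD_prime_power assms(1,3) by blast
  have p_nz: "of_nat p \<noteq> (0 :: 'a)"
    using assms(1,10) by (auto simp: of_nat_eq_0_iff_char_dvd char_a gcd_nat.absorb2)
  note p = assms(6) char_b p_nz
  \<comment> \<open>Both code properties are reduced to the kernel equation having only the zero
    solution.\<close>
  have code: "linear_code (2 * r ^ m) (r ^ m) C \<and> lcd_code (2 * r ^ m) C"
    if "\<And>h. h + Poly_Mapping.single 0 (\<chi> (- 1)) * group_algebra_of \<chi> ^ 2 * h = 0 \<Longrightarrow> h = 0"
  proof -
    have x: "bij_betw x {..<CARD('a)} UNIV"
      using assms(3,14) by simp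
    have "y = 0\<^sub>v CARD('a)"
      if y: "y \<in> carrier_vec CARD('a)"
        and eq: "(1\<^sub>m CARD('a) + P_mat \<phi> 0 x * (P_mat \<phi> 0 x)\<^sup>T) *\<^sub>v y = 0\<^sub>v CARD('a)" for y
    proof -
      have "group_algebra_of (\<lambda>z. y $ (the_inv_into {..<CARD('a)} x z)) = 0"
        using \<open>\<And>h. _ h \<Longrightarrow> h = 0\<close> char_code_eigen[OF mult_character_axioms \<phi>_\<chi> x y eq] by blast
      then have "y $ (the_inv_into {..<CARD('a)} x z) = 0" for z
        by (simp add: group_algebra_of_eq_iff)
      then have "y $ i = 0" if "i < CARD('a)" for i
        using the_inv_into_f_f[OF bij_betw_imp_inj_on[OF x], of i] that by (metis lessThan_iff)
      then show ?thesis
        using y by (intro eq_vecI) auto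
    qed
    from char_code_linear_lcd[OF this] show ?thesis
      unfolding C_def \<phi>_def assms(3) by blast
  qed
  have case1: "linear_code (2 * r ^ m) (r ^ m) C \<and> lcd_code (2 * r ^ m) C"
    if s: "N dvd p ^ s - 1" "\<phi> (of_nat (p ^ (2 * s))) \<noteq> 1" for s
  proof (rule code)
    fix h assume h: "h + Poly_Mapping.single 0 (\<chi> (- 1)) * group_algebra_of \<chi> ^ 2 * h = 0"
    obtain d where "p ^ s - 1 = N * d"
      using s(1) by blast
    moreover have "p ^ s > 0"
      using assms(6) prime_gt_0_nat by simp
    ultimately have "p ^ s = N * d + 1"
      by linarith
    \<comment> \<open>The exponent is 1 modulo N, and N-th powers of character values are 1.\<close>
    then have "\<chi> z ^ (p ^ s) = \<chi> z" if "z \<noteq> 0" for z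
      by (simp add: power_add power_mult \<chi>_N[OF that])
    moreover have "\<chi> (of_nat p) ^ (2 * s) \<noteq> 1"
      using s(2) p_nz by (simp add: \<phi>_\<chi> power)
    ultimately show "h = 0"
      by (rule eq_0_if_power_eq_self[OF p h])
  qed
  have case2: "linear_code (2 * r ^ m) (r ^ m) C \<and> lcd_code (2 * r ^ m) C"
    if s: "N dvd p ^ s + 1" "\<phi> (of_nat p powi (- 2 * int s)) \<noteq> of_nat (r ^ (2 * m))" for s
  proof (rule code)
    fix h assume h: "h + Poly_Mapping.single 0 (\<chi> (- 1)) * group_algebra_of \<chi> ^ 2 * h = 0"
    obtain d where d: "p ^ s + 1 = N * d"
      using s(1) by blast
    have "\<chi> z ^ (p ^ s) = inverse (\<chi> z)" if "z \<noteq> 0" for z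
    proof -
      have "\<chi> z * \<chi> z ^ (p ^ s) = \<chi> z ^ (p ^ s + 1)"
        by simp
      also have "\<dots> = 1"
        unfolding d by (simp add: power_mult \<chi>_N[OF that])
      finally show ?thesis
        by (metis inverse_unique)
    qed
    \<comment> \<open>Dividing by the character value turns equality here into the equality that the
      hypothesis on p^(-2s) excludes.\<close>
    moreover have "\<chi> (of_nat p) ^ (2 * s) * of_nat CARD('a) ^ 2 \<noteq> 1"
    proof
      assume "\<chi> (of_nat p) ^ (2 * s) * of_nat CARD('a) ^ 2 = 1"
      then have "inverse (\<chi> (of_nat p) ^ (2 * s)) = of_nat (r ^ (2 * m))"
        using inverse_unique by (simp add: assms(3) mult.commute[of 2 m] flip: power_mult)
      moreover have "of_nat p powi (- 2 * int s) = inverse (of_nat p ^ (2 * s) :: 'a)"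
        by (simp add: power_int_def nat_mult_distrib power_inverse)
      ultimately show False
        using s(2) p_nz by (simp add: \<phi>_\<chi> inverse power)
    qed
    ultimately show "h = 0"
      by (rule eq_0_if_power_eq_inverse[OF p h \<alpha> \<chi>_\<alpha>])
  qed
  \<comment> \<open>The claim about q^2 is the first case with s = e, where p^s - 1 = q - 1.\<close>
  have "p ^ (2 * e) = q ^ 2"
    by (simp add: assms(8) mult.commute flip: power_mult)
  then show ?thesis
    using case1 case2 assms(8,11) by metis
qed

end
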